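(* For every integer $n\ge 1$, the binomial Ward-Lah numbers $B(n,k)$ satisfy $$\sum_{k=0}^{n}B(n,k)=L(2n,n),$$ where $L(2n,n)$ is the central Lah number.
   Context: Partition transformation: for integers $n,k\ge 0$ and a sequence $a_1,a_2,\dots$, $$P_n^k(a_1,a_2,\dots)=\sum_{q}(-1)^{q_0}\prod_{j=0}^{\ell(q)-1}\binom{q_j}{q_{j+1}}a_{j+1}^{q_j},$$ where the sum is over integer partitions $q=(q_0\ge q_1\ge\dots)$ of $n=q_0+q_1+\cdots$ with $q_0=k$; $\ell(q)$ is the length of $q$ (number of positive parts), so $q_{\ell(q)-1}>0$ and $q_{\ell(q)}=0$. Binomial Ward-Lah numbers: for integers $n\ge k\ge 0$, $B(n,k)=(-1)^k \dfrac{(2n)!}{k!(n-k)!}\,P_n^k(1,1,\dots)$ (all $a_i=1$), with $B(0,0)=1$, $B(n,0)=0$ for $n\ge 1$, $B(0,k)=0$ for $k\ge 1$, and $B(n,k)=0$ for $k>n$. Lah numbers: for integers $n,k\ge1$, $L(n,k)=\dfrac{n!}{k!}\dbinom{n-1}{k-1}$. *)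

theory Defs
  imports Complex_Main
begin

(* An integer partition q_0 >= q_1 >= ... of n is encoded as a weakly decreasing function
   with finite support, i.e. padded with infinitely many zeros. *)
definition partitions_of :: "nat \<Rightarrow> (nat \<Rightarrow> nat) set" where
  "partitions_of n =
     {q. antimono q \<and> finite {j. q j > 0} \<and> (\<Sum>j\<in>{j. q j > 0}. q j) = n}"

definition partition_length :: "(nat \<Rightarrow> nat) \<Rightarrow> nat" where
  "partition_length q = card {j. q j > 0}"

(* The sequence a_1, a_2, ... is a function on nat whose value at 0 is never used. *)
definition partition_transform :: "nat \<Rightarrow> nat \<Rightarrow> (nat \<Rightarrow> 'a::comm_ring_1) \<Rightarrow> 'a" where
  "partition_transform n k a =
     (\<Sum>q\<in>{q \<in> partitions_of n. q 0 = k}.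
        (-1) ^ q 0 * (\<Prod>j<partition_length q. of_nat (q j choose q (j + 1)) * a (j + 1) ^ q j))"

definition binomial_ward_lah :: "nat \<Rightarrow> nat \<Rightarrow> rat" where
  "binomial_ward_lah n k =
     (if k \<le> n
      then (-1) ^ k * (fact (2 * n) / (fact k * fact (n - k))) * partition_transform n k (\<lambda>_. 1)
      else 0)"

(* Only meaningful for n, k >= 1, because of the truncated subtractions. *)
definition lah :: "nat \<Rightarrow> nat \<Rightarrow> rat" where
  "lah n k = fact n / fact k * of_nat ((n - 1) choose (k - 1))"

(* The sum in partition_transform is not a junk value: its index set is finite. *)
lemma finite_partitions_of: "finite (partitions_of n)"
proof (rule finite_subset)
  show "finite {q::nat \<Rightarrow> nat. \<forall>j. (j \<in> {..<n} \<longrightarrow> q j \<in> {..n}) \<and> (j \<notin> {..<n} \<longrightarrow> q j = 0)}"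
    by (rule finite_set_of_finite_funs) auto
  show "partitions_of n \<subseteq>
    {q. \<forall>j. (j \<in> {..<n} \<longrightarrow> q j \<in> {..n}) \<and> (j \<notin> {..<n} \<longrightarrow> q j = 0)}"
  proof
    fix q assume "q \<in> partitions_of n"
    then have anti: "antimono q" and fin: "finite {j. q j > 0}"
      and total: "(\<Sum>j\<in>{j. q j > 0}. q j) = n"
      by (auto simp: partitions_of_def)
    have le: "q j \<le> n" for j
    proof (cases "q j > 0")
      case True
      then show ?thesis
        using member_le_sum[of j "{j. q j > 0}" q] fin total by auto
    qed auto
    have zero: "q j = 0" if "j \<ge> n" for j
    proof (rule ccontr)
      assume "q j \<noteq> 0"
      have sub: "{..j} \<subseteq> {j. q j > 0}"
      proof
        fix i assume "i \<in> {..j}"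
        then have "q j \<le> q i" by (intro antimonoD[OF anti]) simp
        then show "i \<in> {j. q j > 0}" using \<open>q j \<noteq> 0\<close> by simp
      qed
      have "Suc j = (\<Sum>i\<in>{..j}. 1)" by simp
      also have "\<dots> \<le> (\<Sum>i\<in>{..j}. q i)"
        using sub by (intro sum_mono) (auto simp: Suc_le_eq)
      also have "\<dots> \<le> n"
        using sum_mono2[OF fin sub, of q] total by simp
      finally show False using that by simp
    qed
    show "q \<in> {q. \<forall>j. (j \<in> {..<n} \<longrightarrow> q j \<in> {..n}) \<and> (j \<notin> {..<n} \<longrightarrow> q j = 0)}"
      using le zero by auto
  qed
qed

(* The conventional boundary values are consequences of the defining formula. *)
lemma binomial_ward_lah_0_0: "binomial_ward_lah 0 0 = 1"
proof -
  have "{q \<in> partitions_of 0. q 0 = 0} = {\<lambda>_. 0}"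
  proof (intro equalityI subsetI)
    fix q assume q: "q \<in> {q \<in> partitions_of 0. q 0 = 0}"
    have "q j = 0" for j
      using q antimonoD[of q 0 j] by (simp add: partitions_of_def)
    then show "q \<in> {\<lambda>_. 0}" by auto
  qed (simp add: partitions_of_def antimono_def)
  then show ?thesis
    by (simp add: binomial_ward_lah_def partition_transform_def partition_length_def)
qed

lemma binomial_ward_lah_n_0:
  assumes "n \<ge> 1"
  shows "binomial_ward_lah n 0 = 0"
proof -
  have "q \<notin> partitions_of n" if "q 0 = 0" for q
  proof
    assume q: "q \<in> partitions_of n"
    have "q j = 0" for j
      using q antimonoD[of q 0 j] that by (simp add: partitions_of_def)
    then show False using q assms by (auto simp: partitions_of_def)
  qed
  then have "{q \<in> partitions_of n. q 0 = 0} = {}" by auto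
  then show ?thesis
    unfolding binomial_ward_lah_def partition_transform_def by (simp only: sum.empty) simp
qed

lemma binomial_ward_lah_eq_0: "k > n \<Longrightarrow> binomial_ward_lah n k = 0"
  by (simp add: binomial_ward_lah_def)

end

theory Submission
  imports Defs
begin

text \<open>
  Removing the largest part \<open>q 0 = k\<close> of a partition gives a recurrence for the partition
  transform. For the constant sequence 1 it is the recurrence that Vandermonde's identity gives for
  the number \<open>n - 1 choose (k - 1)\<close> of compositions of \<open>n\<close> into \<open>k\<close> parts. Hence
  \<open>B(n,k) = (2n)! / n! * (n choose k) * (n - 1 choose (k - 1))\<close>, and a second
  application of Vandermonde's identity sums this over \<open>k\<close>.
\<close>

text \<open>\<open>case_nat k q\<close> is the sequence \<open>q\<close> with \<open>k\<close>
  prepended. This is how a largest part is added to a partition, so sums over the support split off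
  the summand \<open>k\<close>.\<close>

lemma support_case_nat:
  assumes "k > 0"
  shows "{j. case_nat k q j > 0} = insert 0 (Suc ` {j. q j > (0::nat)})"
proof (rule set_eqI)
  fix j
  show "j \<in> {j. case_nat k q j > 0} \<longleftrightarrow> j \<in> insert 0 (Suc ` {j. q j > 0})"
    using assms by (cases j) auto
qed

lemma case_nat_in_partitions_of_iff:
  assumes "0 < k" "k \<le> n"
  shows "case_nat k q \<in> partitions_of n \<longleftrightarrow> q 0 \<le> k \<and> q \<in> partitions_of (n - k)"
proof -
  have anti: "antimono (case_nat k q) \<longleftrightarrow> q 0 \<le> k \<and> antimono q"
    unfolding antimono_iff_le_Suc by (auto split: nat.splits)
  have fin: "finite {j. case_nat k q j > 0} \<longleftrightarrow> finite {j. q j > 0}"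
    by (simp add: support_case_nat[OF \<open>0 < k\<close>] finite_image_iff)
  have "(\<Sum>j\<in>{j. case_nat k q j > 0}. case_nat k q j) = k + (\<Sum>j\<in>{j. q j > 0}. q j)"
    if "finite {j. q j > 0}"
    using that by (simp add: support_case_nat[OF \<open>0 < k\<close>] sum.reindex)
  then show ?thesis
    using anti fin \<open>k \<le> n\<close> by (auto simp: partitions_of_def)
qed

lemma partition_length_case_nat:
  assumes "0 < k" "q \<in> partitions_of n"
  shows "partition_length (case_nat k q) = Suc (partition_length q)"
  using assms
  by (simp add: partition_length_def support_case_nat partitions_of_def card_image)

lemma case_nat_shift: "q 0 = k \<Longrightarrow> case_nat k (\<lambda>j. q (Suc j)) = q"
  by (auto split: nat.splits)

text \<open>Group the partitions by their second part \<open>m = q 1\<close>. The first factor of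
  the product depends only on \<open>k\<close> and \<open>m\<close>; the other factors form the
  weight of the tail, a partition of \<open>n - k\<close> with largest part \<open>m\<close>, for
  the sequence shifted by one.\<close>

lemma partition_transform_rec:
  assumes "0 < k" "k \<le> n"
  shows "partition_transform n k a = (- a 1) ^ k *
    (\<Sum>m\<le>k. (-1) ^ m * of_nat (k choose m) * partition_transform (n - k) m (\<lambda>j. a (Suc j)))"
proof -
  let ?S = "\<lambda>m. {q \<in> partitions_of (n - k). q 0 = m}"
  let ?w = "\<lambda>a q. (\<Prod>j<partition_length q. of_nat (q j choose q (j + 1)) * a (j + 1) ^ q j)"
  have fin: "finite (?S m)" for m
    using finite_partitions_of by simp
  \<comment> \<open>The length grows by one, so the factor at index 0 splits off; it is determined
    by the first two entries \<open>k\<close> and \<open>q 0 = m\<close>.\<close>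
  have w: "?w a (case_nat k q) = of_nat (k choose m) * a 1 ^ k * ?w (\<lambda>j. a (Suc j)) q"
    if "q \<in> ?S m" for q m
    using that by (auto simp: partition_length_case_nat[OF \<open>0 < k\<close>] prod.lessThan_Suc_shift
      simp del: prod.lessThan_Suc)
  have "partition_transform n k a =
      (\<Sum>q\<in>{q \<in> partitions_of n. q 0 = k}. (-1) ^ k * ?w a q)"
    unfolding partition_transform_def by (rule sum.cong) auto
  also have "\<dots> = (\<Sum>(m, q)\<in>Sigma {..k} ?S. (-1) ^ k * ?w a (case_nat k q))"
  \<comment> \<open>A partition corresponds to its tail, tagged with the tail's first entry; the
    inverse prepends \<open>k\<close>.\<close>
  proof (rule sum.reindex_bij_witness[of _ "\<lambda>(m, q). case_nat k q" "\<lambda>q. (q 1, \<lambda>j. q (Suc j))"])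
    fix q assume "q \<in> {q \<in> partitions_of n. q 0 = k}"
    then have q: "q \<in> partitions_of n" "q 0 = k" by auto
    show "(case (q 1, \<lambda>j. q (Suc j)) of (m, q) \<Rightarrow> case_nat k q) = q"
      using case_nat_shift[of q, OF q(2)] by simp
    show "(q 1, \<lambda>j. q (Suc j)) \<in> Sigma {..k} ?S"
      using case_nat_in_partitions_of_iff[OF assms, of "\<lambda>j. q (Suc j)"] q case_nat_shift[of q, OF q(2)]
      by simp
    show "(case (q 1, \<lambda>j. q (Suc j)) of (m, q) \<Rightarrow> (-1) ^ k * ?w a (case_nat k q)) =
        (-1) ^ k * ?w a q"
      using case_nat_shift[of q, OF q(2)] by simp
  qed (auto simp: case_nat_in_partitions_of_iff[OF assms])
  also have "\<dots> = (\<Sum>m\<le>k. \<Sum>q\<in>?S m. (-1) ^ k * ?w a (case_nat k q))"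
    using fin by (simp add: sum.Sigma)
  also have "\<dots> = (\<Sum>m\<le>k. (- a 1) ^ k * ((-1) ^ m * of_nat (k choose m) *
      partition_transform (n - k) m (\<lambda>j. a (Suc j))))"
  proof (rule sum.cong[OF refl])
    fix m
    have "(\<Sum>q\<in>?S m. (-1) ^ k * ?w a (case_nat k q)) =
        (\<Sum>q\<in>?S m. (- a 1) ^ k * ((-1) ^ m * of_nat (k choose m) *
          ((-1) ^ q 0 * ?w (\<lambda>j. a (Suc j)) q)))"
    proof (rule sum.cong[OF refl])
      fix q assume q: "q \<in> ?S m"
      \<comment> \<open>The transform of the tail carries the sign \<open>(-1) ^ q 0\<close> with
        \<open>q 0 = m\<close>; the extra \<open>(-1) ^ m\<close> cancels it.\<close>
      have "(-1) ^ m * (-1) ^ m = (1 :: 'a)"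
        by (simp flip: power_add)
      then have sgn: "(-1) ^ m * ((-1) ^ m * x) = x" for x :: 'a
        by (metis mult.assoc mult_1)
      show "(-1) ^ k * ?w a (case_nat k q) = (- a 1) ^ k * ((-1) ^ m * of_nat (k choose m) *
          ((-1) ^ q 0 * ?w (\<lambda>j. a (Suc j)) q))"
        unfolding w[OF q] using q
        by (simp add: power_minus[of "a (Suc 0)"] sgn mult.left_commute mult.assoc)
    qed
    then show "(\<Sum>q\<in>?S m. (-1) ^ k * ?w a (case_nat k q)) = (- a 1) ^ k *
        ((-1) ^ m * of_nat (k choose m) * partition_transform (n - k) m (\<lambda>j. a (Suc j)))"
      by (simp add: partition_transform_def sum_distrib_left)
  qed
  finally show ?thesis
    by (simp only: sum_distrib_left)
qed

lemma partition_transform_eq_0: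
  assumes "n < k"
  shows "partition_transform n k a = 0"
proof -
  have "q 0 \<le> n" if "q \<in> partitions_of n" for q
    using that member_le_sum[of 0 "{j. q j > 0}" q] by (cases "q 0 > 0") (auto simp: partitions_of_def)
  then have "{q \<in> partitions_of n. q 0 = k} = {}"
    using assms by fastforce
  then show ?thesis
    unfolding partition_transform_def by (simp only: sum.empty)
qed

lemma partition_transform_n_0:
  assumes "n > 0"
  shows "partition_transform n 0 (\<lambda>_. 1) = (0 :: rat)"
  \<comment> \<open>The factorial quotient in \<open>binomial_ward_lah\<close> is nonzero, so the
    transform itself must vanish.\<close>
  using binomial_ward_lah_n_0[of n] assms by (simp add: binomial_ward_lah_def)

lemma partition_transform_0_0: "partition_transform 0 0 (\<lambda>_. 1) = (1 :: rat)"
  using binomial_ward_lah_0_0 by (simp add: binomial_ward_lah_def)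

text \<open>Vandermonde's identity for \<open>k + (r - 1)\<close>, with the second binomial
  reflected. It serves twice: with \<open>r = n - k\<close> in the recurrence and with
  \<open>k = r = n\<close> in the final sum.\<close>

lemma vandermonde_pred:
  assumes "r > 0"
  shows "(\<Sum>m=1..k. (k choose m) * (r - 1 choose (m - 1))) = (k + r - 1 choose r)"
proof -
  have "(k + r - 1 choose r) = (k + (r - 1) choose r)"
    using assms by simp
  also have "\<dots> = (\<Sum>m\<le>r. (k choose m) * (r - 1 choose (r - m)))"
    by (rule vandermonde[symmetric])
  \<comment> \<open>The term at \<open>m = 0\<close> contains \<open>r - 1 choose r\<close>, which
    is 0.\<close>
  also have "\<dots> = (\<Sum>m=1..r. (k choose m) * (r - 1 choose (r - m)))"
    using assms by (intro sum.mono_neutral_right) (auto simp: not_less_eq_eq)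
  also have "\<dots> = (\<Sum>m=1..r. (k choose m) * (r - 1 choose (m - 1)))"
  proof (rule sum.cong[OF refl])
    fix m assume "m \<in> {1..r}"
    then have "m - 1 \<le> r - 1" "r - 1 - (m - 1) = r - m" by auto
    then show "(k choose m) * (r - 1 choose (r - m)) = (k choose m) * (r - 1 choose (m - 1))"
      using binomial_symmetric[of "m - 1" "r - 1"] by simp
  qed
  \<comment> \<open>Terms between the two upper limits vanish: \<open>k choose m\<close> for
    \<open>m > k\<close>, and \<open>r - 1 choose (m - 1)\<close> for \<open>m > r\<close>.\<close>
  also have "\<dots> = (\<Sum>m=1..k. (k choose m) * (r - 1 choose (m - 1)))"
    by (rule sum.mono_neutral_cong) (use assms in auto)
  finally show ?thesis ..
qed

text \<open>Strong induction on \<open>n\<close> for all \<open>k\<close> at once: removing the part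
  \<open>k > 0\<close> leaves the smaller number \<open>n - k\<close>, and the signs in the
  recurrence cancel those of the closed form.\<close>

lemma partition_transform_1:
  assumes "n > 0" "k > 0"
  shows "partition_transform n k (\<lambda>_. 1) = ((-1) ^ k * of_nat (n - 1 choose (k - 1)) :: rat)"
  using assms
proof (induction n arbitrary: k rule: less_induct)
  case (less n)
  let ?T = "\<lambda>n m. partition_transform n m (\<lambda>_. 1) :: rat"
  consider "n < k" | "n = k" | "k < n" by linarith
  then show ?case
  proof cases
    case 1
    then show ?thesis using less.prems by (simp add: partition_transform_eq_0)
  next
    case 2
    \<comment> \<open>Nothing remains after removing the part \<open>k = n\<close>, so only the
      empty partition contributes.\<close>
    have "(\<Sum>m\<le>k. (-1) ^ m * of_nat (k choose m) * ?T 0 m) =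
        (\<Sum>m\<in>{0}. (-1) ^ m * of_nat (k choose m) * ?T 0 m)"
      by (rule sum.mono_neutral_right) (auto simp: partition_transform_eq_0)
    then show ?thesis
      using partition_transform_rec[of k n "\<lambda>_. 1 :: rat"] less.prems 2
      by (simp add: partition_transform_0_0)
  next
    case 3
    \<comment> \<open>The term at \<open>m = 0\<close> must go before the induction hypothesis is
      used: there \<open>m - 1\<close> truncates to 0 and the closed form would give 1 instead of
      0.\<close>
    have "(\<Sum>m\<le>k. (-1) ^ m * of_nat (k choose m) * ?T (n - k) m) =
        (\<Sum>m=1..k. (-1) ^ m * of_nat (k choose m) * ?T (n - k) m)"
      using 3 by (intro sum.mono_neutral_right) (auto simp: not_less_eq_eq partition_transform_n_0)
    also have "\<dots> = (\<Sum>m=1..k. of_nat ((k choose m) * (n - k - 1 choose (m - 1))))"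
    proof (rule sum.cong[OF refl])
      fix m assume "m \<in> {1..k}"
      then have "?T (n - k) m = (-1) ^ m * of_nat (n - k - 1 choose (m - 1))"
        using less.IH[of "n - k" m] less.prems 3 by simp
      moreover have "(-1) ^ m * (-1) ^ m = (1 :: rat)"
        by (simp flip: power_add)
      ultimately show "(-1) ^ m * of_nat (k choose m) * ?T (n - k) m =
          of_nat ((k choose m) * (n - k - 1 choose (m - 1)))"
        by simp
    qed
    \<comment> \<open>With \<open>r = n - k\<close> the top entry \<open>k + r - 1\<close> is
      \<open>n - 1\<close>.\<close>
    also have "\<dots> = of_nat (n - 1 choose (n - k))"
      using vandermonde_pred[of "n - k" k] 3 by (simp flip: of_nat_sum of_nat_mult)
    also have "(n - 1 choose (n - k)) = (n - 1 choose (k - 1))"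
      using binomial_symmetric[of "k - 1" "n - 1"] 3 less.prems by simp
    finally show ?thesis
      using partition_transform_rec[of k n "\<lambda>_. 1 :: rat"] less.prems 3 by simp
  qed
qed

text \<open>The sign in the definition cancels that of the transform, and
  \<open>fact n / (fact k * fact (n - k))\<close> is absorbed into
  \<open>n choose k\<close>.\<close>

lemma binomial_ward_lah_eq:
  assumes "0 < k" "k \<le> n"
  shows "binomial_ward_lah n k =
    fact (2 * n) / fact n * of_nat ((n choose k) * (n - 1 choose (k - 1)))"
proof -
  have "(-1) ^ k * (-1) ^ k = (1 :: rat)"
    by (simp flip: power_add)
  then show ?thesis
    using assms
    by (simp add: binomial_ward_lah_def partition_transform_1 binomial_fact)
qed

theorem theorem6p9:
  fixes n :: nat
  assumes "n \<ge> 1"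
  shows "(\<Sum>k=0..n. binomial_ward_lah n k) = lah (2 * n) n"
proof -
  have "(\<Sum>k=0..n. binomial_ward_lah n k) = (\<Sum>k=1..n. binomial_ward_lah n k)"
    using assms
    by (intro sum.mono_neutral_right) (auto simp: not_less_eq_eq binomial_ward_lah_n_0)
  also have "\<dots> = fact (2 * n) / fact n *
      of_nat (\<Sum>k=1..n. (n choose k) * (n - 1 choose (k - 1)))"
    by (simp add: binomial_ward_lah_eq sum_distrib_left)
  also have "(\<Sum>k=1..n. (n choose k) * (n - 1 choose (k - 1))) = (2 * n - 1 choose n)"
    using vandermonde_pred[of n n] assms by (simp add: mult_2)
  \<comment> \<open>Reflection gives the lower index \<open>n - 1\<close> that
    \<open>lah (2 * n) n\<close> uses.\<close>
  also have "(2 * n - 1 choose n) = (2 * n - 1 choose (n - 1))"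
    using binomial_symmetric[of n "2 * n - 1"] assms by (simp add: mult_2)
  finally show ?thesis
    by (simp add: lah_def)
qed

end
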